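(* Let $N\ge2$, let $T_1=T_{f_1,w_1},\dots,T_N=T_{f_N,w_N}$ be unilateral pseudo-shifts on $c_0(\mathbb{N})$, and let $\mathcal{A}=\mathcal{A}_{uBd}$ or $\mathcal{A}=\mathcal{A}_{ud}$. If $\mathcal{A}$ is $(f_s)_{s=1}^N$-almost partition regular, then $T_1,\dots,T_N$ are disjoint $\mathcal{A}$-hypercyclic if and only if for any $l\ge1$, any scalars $(a_{s,j})_{s\in[N],j\in[l]}$ with all $a_{s,j}\ne0$, and any $\varepsilon>0$, there exists $A\in\mathcal{A}$ such that: (1) for any $j\in[l]$ and any $s\in[N]$, $\lim_{n\in A}|W^s_{j,n}|=\infty$ (the limit as $n\to\infty$ along $A$); (2) for any $j\in[l]$, any $n\in A$, any $s,t\in[N]$, any $m\in A$ with $f_t^m(j)\in f_s^n((l,+\infty))$, $$\frac{|W^s_{f_s^{-n}(f_t^m(j)),n}|}{|W^t_{j,m}|}\le\varepsilon;$$ (3) for any $n\in A$, any $s\ne t\in[N]$ and any $j\in f_t^n([l])\cap f_s^n([l])$, $$\left|\frac{W^s_{f_s^{-n}(j),n}}{W^t_{f_t^{-n}(j),n}}-\frac{a_{s,f_s^{-n}(j)}}{a_{t,f_t^{-n}(j)}}\right|\le\varepsilon.$$ Here $W^s_{l,n}=\prod_{\nu=1}^nw_{s,f_s^\nu(l)}$ for all $s\in[N]$.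
   Context: $\mathbb{N}=\{1,2,\dots\}$, $[l]=\{1,\dots,l\}$, $(l,\infty)$ denotes the integers $>l$; spaces are over $\mathbb{K}=\mathbb{R}$ or $\mathbb{C}$ with canonical basis $(e_j)_{j\ge1}$. $f^n$ is the $n$-th iterate of $f$ and, for injective $f$, $f^{-n}$ is the inverse of $f^n$ on its range. Pseudo-shift: for a bounded weight sequence of scalars $w=(w_j)_{j\in\mathbb{N}}$ and a strictly increasing $f:\mathbb{N}\to\mathbb{N}$ with $f(1)>1$, $T_{f,w}\big(\sum_{j\ge1}x_je_j\big)=\sum_{j\ge1}w_{f(j)}x_{f(j)}e_j$. We write $w_s=(w_{s,j})_{j\in\mathbb{N}}$. For $A\subset\mathbb{N}$: $\overline{\mathrm{dens}}\,A=\limsup_{M\to\infty}\frac{\mathrm{card}\{n\le M:n\in A\}}{M}$, $\overline{\mathrm{Bd}}\,A=\limsup_{M\to\infty}\max_{k\ge1}\frac{\mathrm{card}(A\cap\{k+1,\dots,k+M\})}{M}$. $\mathcal{A}_{uBd}$ and $\mathcal{A}_{ud}$ are the families of subsets of $\mathbb{N}$ of positive upper Banach density and positive upper density, respectively. $T_1,\dots,T_N$ are disjoint $\mathcal{A}$-hypercyclic if there is $x\in X$ (here $X=c_0(\mathbb{N})$) such that for all non-empty open $V_1,\dots,V_N\subset X$, $\{n:T_s^nx\in V_s\text{ for all }s\in[N]\}\in\mathcal{A}$. $\mathcal{A}$ is $(f_s)_{s=1}^N$-almost partition regular if for any $l\ge1$ and any $B\in\mathcal{A}$ there exists $A\subseteq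 B$ with $A\in\mathcal{A}$ such that $f_s^m([l])\cap f_t^n([l])=\emptyset$ for all $m,n\in A$ with $m\ne n$ and all $s,t\in[N]$. *)

theory Defs
  imports "HOL-Analysis.Analysis"
begin

text \<open>
  Throughout, the natural numbers of the source are \<open>{1..} :: nat set\<close>. Sequences indexed by
  them are functions on \<^typ>\<open>nat\<close> whose value at \<open>0\<close> is irrelevant, except in the space \<open>c\<^sub>0\<close>,
  whose elements are normalised to vanish there.

  The scalar field is a type of sort \<open>{real_normed_field, euclidean_space}\<close>: a commutative field that
  is a finite-dimensional real algebra with multiplicative norm. Up to isometric isomorphism these are
  exactly \<open>\<real>\<close> and \<open>\<complex>\<close>, so both cases are covered by one statement.
\<close>

section \<open>The Banach space of null sequences\<close>

typedef (overloaded) ('a::real_normed_vector) c0 = "{x :: nat \<Rightarrow> 'a. x 0 = 0 \<and> x \<longlonglongrightarrow> 0}"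
  morphisms coord Abs_c0
  by (rule exI[of _ "\<lambda>_. 0"]) simp

setup_lifting type_definition_c0

lemma coord_0 [simp]: "coord x 0 = 0"
  using coord[of x] by simp

lemma coord_tendsto_0: "coord x \<longlonglongrightarrow> 0"
  using coord[of x] by simp

lemma c0_eqI: "(\<And>j. coord x j = coord y j) \<Longrightarrow> x = y"
  by (simp add: coord_inject[symmetric] fun_eq_iff)

lemma bdd_above_norm_coord: "bdd_above ((\<lambda>j. norm (coord x j)) ` A)"
proof -
  have "Bseq (coord x)"
    using coord_tendsto_0 convergentI convergent_imp_Bseq by blast
  then obtain K where "\<And>j. norm (coord x j) \<le> K"
    by (auto simp: Bseq_def)
  then show ?thesis
    by (intro bdd_aboveI2)
qed

instantiation c0 :: (real_normed_vector) real_normed_vector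
begin

lift_definition zero_c0 :: "'a c0" is "\<lambda>_. 0"
  by simp

lift_definition plus_c0 :: "'a c0 \<Rightarrow> 'a c0 \<Rightarrow> 'a c0" is "\<lambda>x y j. x j + y j"
  by (auto intro: tendsto_add_zero)

lift_definition minus_c0 :: "'a c0 \<Rightarrow> 'a c0 \<Rightarrow> 'a c0" is "\<lambda>x y j. x j - y j"
  using tendsto_diff by fastforce

lift_definition uminus_c0 :: "'a c0 \<Rightarrow> 'a c0" is "\<lambda>x j. - x j"
  using tendsto_minus by fastforce

lift_definition scaleR_c0 :: "real \<Rightarrow> 'a c0 \<Rightarrow> 'a c0" is "\<lambda>r x j. r *\<^sub>R x j"
  using tendsto_scaleR[OF tendsto_const] by fastforce

definition norm_c0 :: "'a c0 \<Rightarrow> real"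
  where "norm x = (SUP j\<in>{1..}. norm (coord x j))"

definition dist_c0 :: "'a c0 \<Rightarrow> 'a c0 \<Rightarrow> real"
  where "dist x y = norm (x - y)" for x y :: "'a c0"

definition sgn_c0 :: "'a c0 \<Rightarrow> 'a c0"
  where "sgn x = inverse (norm x) *\<^sub>R x" for x :: "'a c0"

definition uniformity_c0 :: "('a c0 \<times> 'a c0) filter"
  where "uniformity_c0 = (INF e\<in>{0<..}. principal {(x, y). dist x y < e})"

definition open_c0 :: "'a c0 set \<Rightarrow> bool"
  where "open_c0 U = (\<forall>x\<in>U. \<forall>\<^sub>F (x', y) in uniformity. x' = x \<longrightarrow> y \<in> U)"

lemma norm_coord_le: "norm (coord x j) \<le> norm x" for x :: "'a c0"
proof (cases "j = 0")
  case True
  have "0 \<le> norm (coord x 1)" by simp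
  also have "\<dots> \<le> norm x"
    unfolding norm_c0_def by (intro cSUP_upper bdd_above_norm_coord) simp
  finally show ?thesis using True by simp
next
  case False
  then show ?thesis
    unfolding norm_c0_def by (intro cSUP_upper bdd_above_norm_coord) simp
qed

lemma norm_c0_leI: "(\<And>j. j \<ge> 1 \<Longrightarrow> norm (coord x j) \<le> B) \<Longrightarrow> norm x \<le> B" for x :: "'a c0"
  unfolding norm_c0_def by (rule cSUP_least) auto

instance
proof
  fix a b :: real and x y z :: "'a c0" and U :: "'a c0 set"
  show "x + y + z = x + (y + z)" "x + y = y + x" "0 + x = x" "- x + x = 0" "x - y = x + - y"
    by (transfer; simp add: fun_eq_iff)+
  show "a *\<^sub>R (x + y) = a *\<^sub>R x + a *\<^sub>R y" "(a + b) *\<^sub>R x = a *\<^sub>R x + b *\<^sub>R x"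
    "a *\<^sub>R b *\<^sub>R x = (a * b) *\<^sub>R x" "1 *\<^sub>R x = x"
    by (transfer; simp add: fun_eq_iff algebra_simps)+
  show "dist x y = norm (x - y)" "sgn x = inverse (norm x) *\<^sub>R x"
    "(uniformity :: ('a c0 \<times> 'a c0) filter) = (INF e\<in>{0<..}. principal {(x, y). dist x y < e})"
    "open U \<longleftrightarrow> (\<forall>x\<in>U. \<forall>\<^sub>F (x', y) in uniformity. x' = x \<longrightarrow> y \<in> U)"
    by (fact dist_c0_def sgn_c0_def uniformity_c0_def open_c0_def)+
  show "norm x = 0 \<longleftrightarrow> x = 0"
  proof
    assume "norm x = 0"
    then have "coord x j = 0" for j
      using norm_coord_le[of x j] by simp
    then show "x = 0"
      by (intro c0_eqI) (simp add: zero_c0.rep_eq)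
  next
    assume "x = 0"
    then show "norm x = 0"
      by (simp add: norm_c0_def zero_c0.rep_eq)
  qed
  show "norm (x + y) \<le> norm x + norm y"
  proof (rule norm_c0_leI)
    fix j
    have "norm (coord (x + y) j) \<le> norm (coord x j) + norm (coord y j)"
      by (simp add: plus_c0.rep_eq norm_triangle_ineq)
    also have "\<dots> \<le> norm x + norm y"
      by (intro add_mono norm_coord_le)
    finally show "norm (coord (x + y) j) \<le> norm x + norm y" .
  qed
  have le: "norm (r *\<^sub>R u) \<le> \<bar>r\<bar> * norm u" for r and u :: "'a c0"
    by (rule norm_c0_leI) (simp add: scaleR_c0.rep_eq mult_left_mono norm_coord_le)
  show "norm (a *\<^sub>R x) = \<bar>a\<bar> * norm x"
  proof (cases "a = 0")
    case True
    then show ?thesis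
      by (simp add: norm_c0_def scaleR_c0.rep_eq)
  next
    case False
    have "\<bar>a\<bar> * norm (inverse a *\<^sub>R a *\<^sub>R x) \<le> \<bar>a\<bar> * (\<bar>inverse a\<bar> * norm (a *\<^sub>R x))"
      by (intro mult_left_mono le) simp
    moreover have "inverse a *\<^sub>R a *\<^sub>R x = x"
      using False by (intro c0_eqI) (simp add: scaleR_c0.rep_eq)
    ultimately have "\<bar>a\<bar> * norm x \<le> norm (a *\<^sub>R x)"
      using False by (simp add: field_simps)
    with le[of a x] show ?thesis by simp
  qed
qed

end

instance c0 :: (banach) banach
proof
  fix X :: "nat \<Rightarrow> 'a c0"
  assume "Cauchy X"
  then have C: "\<exists>M. \<forall>m\<ge>M. \<forall>n\<ge>M. norm (X m - X n) < e" if "e > 0" for e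
    using that by (simp add: Cauchy_iff)
  have coord_diff: "norm (coord (X m) j - coord (X n) j) \<le> norm (X m - X n)" for m n j
    using norm_coord_le[of "X m - X n" j] by (simp add: minus_c0.rep_eq)
  have "convergent (\<lambda>n. coord (X n) j)" for j
  proof (intro Cauchy_convergent CauchyI)
    fix e :: real assume "e > 0"
    then obtain M where "\<And>m n. m \<ge> M \<Longrightarrow> n \<ge> M \<Longrightarrow> norm (X m - X n) < e"
      using C by blast
    then show "\<exists>M. \<forall>m\<ge>M. \<forall>n\<ge>M. norm (coord (X m) j - coord (X n) j) < e"
      using le_less_trans[OF coord_diff] by blast
  qed
  then obtain L where L: "\<And>j. (\<lambda>n. coord (X n) j) \<longlonglongrightarrow> L j"
    unfolding convergent_def by metis
  have unif: "\<exists>M. \<forall>m\<ge>M. \<forall>j. norm (coord (X m) j - L j) \<le> e" if "e > 0" for e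
  proof -
    obtain M where M: "\<And>m n. m \<ge> M \<Longrightarrow> n \<ge> M \<Longrightarrow> norm (X m - X n) < e"
      using C[OF \<open>e > 0\<close>] by blast
    have "norm (coord (X m) j - L j) \<le> e" if "m \<ge> M" for m j
    proof (rule tendsto_upperbound)
      show "(\<lambda>n. norm (coord (X m) j - coord (X n) j)) \<longlonglongrightarrow> norm (coord (X m) j - L j)"
        by (intro tendsto_intros L)
      show "\<forall>\<^sub>F n in sequentially. norm (coord (X m) j - coord (X n) j) \<le> e"
        using eventually_ge_at_top[of M]
        by eventually_elim (meson M coord_diff less_imp_le order_trans that)
    qed simp
    then show ?thesis by blast
  qed
  have "L \<longlonglongrightarrow> 0"
  proof (rule LIMSEQ_I)
    fix r :: real assume "r > 0"
    then obtain m where m: "\<And>j. norm (coord (X m) j - L j) \<le> r / 2"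
      using unif[of "r / 2"] by auto
    obtain J where J: "\<And>j. j \<ge> J \<Longrightarrow> norm (coord (X m) j) < r / 2"
      using LIMSEQ_D[OF coord_tendsto_0[of "X m"], of "r / 2"] \<open>r > 0\<close> by auto
    have "norm (L j - 0) < r" if "j \<ge> J" for j
      using m[of j] J[OF that] norm_triangle_ineq4[of "coord (X m) j" "coord (X m) j - L j"] by simp
    then show "\<exists>no. \<forall>n\<ge>no. norm (L n - 0) < r" by blast
  qed
  moreover have "L 0 = 0"
    using L[of 0] by (simp add: LIMSEQ_const_iff)
  ultimately have coord_L: "coord (Abs_c0 L) = L"
    by (simp add: Abs_c0_inverse)
  have "X \<longlonglongrightarrow> Abs_c0 L"
  proof (rule LIMSEQ_I)
    fix r :: real assume "r > 0"
    then obtain M where M: "\<And>m j. m \<ge> M \<Longrightarrow> norm (coord (X m) j - L j) \<le> r / 2"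
      using unif[of "r / 2"] by auto
    have "norm (X m - Abs_c0 L) < r" if "m \<ge> M" for m
    proof -
      have "norm (X m - Abs_c0 L) \<le> r / 2"
        using M[OF that] by (intro norm_c0_leI) (simp only: minus_c0.rep_eq coord_L)
      with \<open>r > 0\<close> show ?thesis by simp
    qed
    then show "\<exists>no. \<forall>n\<ge>no. norm (X n - Abs_c0 L) < r" by blast
  qed
  then show "convergent X"
    by (rule convergentI)
qed


section \<open>Pseudo-shifts\<close>

definition pseudo_shift_data :: "(nat \<Rightarrow> nat) \<Rightarrow> (nat \<Rightarrow> 'a::real_normed_field) \<Rightarrow> bool"
  where "pseudo_shift_data f w \<longleftrightarrow> strict_mono_on {1..} f \<and> f 1 > 1 \<and> bounded (w ` {1..})"

text \<open>
  \<^const>\<open>Abs_c0\<close> is applied to a genuine null sequence whenever \<^const>\<open>pseudo_shift_data\<close> holds, see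
  \<open>coord_pseudo_shift\<close> below.
\<close>

definition pseudo_shift ::
    "(nat \<Rightarrow> nat) \<Rightarrow> (nat \<Rightarrow> 'a::real_normed_field) \<Rightarrow> 'a c0 \<Rightarrow> 'a c0"
  where "pseudo_shift f w x = Abs_c0 (\<lambda>j. if j = 0 then 0 else w (f j) * coord x (f j))"

lemma coord_pseudo_shift:
  assumes "pseudo_shift_data f w" and "j \<ge> 1"
  shows "coord (pseudo_shift f w x) j = w (f j) * coord x (f j)"
proof -
  have mono: "f i < f k" if "1 \<le> i" "i < k" for i k
    using assms(1) that by (auto simp: pseudo_shift_data_def strict_mono_on_def)
  have ge: "f (Suc k) \<ge> Suc k" for k
  proof (induction k)
    case 0
    show ?case using assms(1) by (simp add: pseudo_shift_data_def)
  next
    case (Suc k)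
    show ?case using mono[of "Suc k" "Suc (Suc k)"] Suc by simp
  qed
  obtain K where K: "\<And>i. i \<ge> 1 \<Longrightarrow> norm (w i) \<le> K"
    using assms(1) by (auto simp: pseudo_shift_data_def bounded_iff)
  have filt: "filterlim (\<lambda>k. f (Suc k)) sequentially sequentially"
    by (rule filterlim_at_top_mono[OF filterlim_Suc]) (simp add: ge)
  have x0: "(\<lambda>k. coord x (f (Suc k))) \<longlonglongrightarrow> 0"
    by (rule filterlim_compose[OF coord_tendsto_0 filt])
  have "(\<lambda>k. w (f (Suc k)) * coord x (f (Suc k))) \<longlonglongrightarrow> 0"
  proof (rule tendsto_0_le[OF x0])
    show "\<forall>\<^sub>F k in sequentially.
        norm (w (f (Suc k)) * coord x (f (Suc k))) \<le> norm (coord x (f (Suc k))) * K"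
    proof (intro always_eventually allI)
      fix k
      have "norm (w (f (Suc k))) \<le> K"
        using ge[of k] by (intro K) simp
      then show "norm (w (f (Suc k)) * coord x (f (Suc k))) \<le> norm (coord x (f (Suc k))) * K"
        by (simp add: norm_mult mult.commute mult_right_mono)
    qed
  qed
  then have "(\<lambda>j. if j = 0 then 0 else w (f j) * coord x (f j)) \<longlonglongrightarrow> 0"
    by (subst filterlim_sequentially_Suc[symmetric]) simp
  then show ?thesis
    using assms(2) by (simp add: pseudo_shift_def Abs_c0_inverse)
qed

definition weight_prod ::
    "(nat \<Rightarrow> nat) \<Rightarrow> (nat \<Rightarrow> 'a::real_normed_field) \<Rightarrow> nat \<Rightarrow> nat \<Rightarrow> 'a"
  where "weight_prod f w l n = (\<Prod>\<nu>=1..n. w ((f ^^ \<nu>) l))"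

text \<open>
  Only values on \<open>(f ^^ n) ` {1..}\<close> are meaningful.
\<close>

definition iter_inv :: "(nat \<Rightarrow> nat) \<Rightarrow> nat \<Rightarrow> nat \<Rightarrow> nat"
  where "iter_inv f n = inv_into {1..} (f ^^ n)"


section \<open>Families of sets of natural numbers\<close>

definition upper_density :: "nat set \<Rightarrow> ereal"
  where "upper_density A = limsup (\<lambda>M. ereal (real (card (A \<inter> {1..M})) / real M))"

definition upper_Banach_density :: "nat set \<Rightarrow> ereal"
  where "upper_Banach_density A =
    limsup (\<lambda>M. ereal (real (MAX k\<in>{1..}. card (A \<inter> {k+1..k+M})) / real M))"

lemma finite_card_windows: "finite ((\<lambda>k. card (A \<inter> {k+1..k+M})) ` {1..})" for A :: "nat set"
proof (rule finite_subset)
  have "card (A \<inter> {k+1..k+M}) \<le> M" for k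
    using card_mono[of "{k+1..k+M}" "A \<inter> {k+1..k+M}"] by simp
  then show "(\<lambda>k. card (A \<inter> {k+1..k+M})) ` {1..} \<subseteq> {..M}" by auto
qed simp

definition A_ud :: "nat set set"
  where "A_ud = {A. A \<subseteq> {1..} \<and> upper_density A > 0}"

definition A_uBd :: "nat set set"
  where "A_uBd = {A. A \<subseteq> {1..} \<and> upper_Banach_density A > 0}"

definition almost_partition_regular :: "nat set set \<Rightarrow> nat \<Rightarrow> (nat \<Rightarrow> nat \<Rightarrow> nat) \<Rightarrow> bool"
  where "almost_partition_regular \<A> N f \<longleftrightarrow>
    (\<forall>l\<ge>1. \<forall>B\<in>\<A>. \<exists>A\<in>\<A>. A \<subseteq> B \<and>
      (\<forall>m\<in>A. \<forall>n\<in>A. m \<noteq> n \<longrightarrow>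
        (\<forall>s\<in>{1..N}. \<forall>t\<in>{1..N}. (f s ^^ m) ` {1..l} \<inter> (f t ^^ n) ` {1..l} = {})))"


section \<open>Disjoint hypercyclicity with respect to a family\<close>

definition disjoint_hypercyclic ::
    "nat set set \<Rightarrow> nat \<Rightarrow> (nat \<Rightarrow> 'x::topological_space \<Rightarrow> 'x) \<Rightarrow> bool"
  where "disjoint_hypercyclic \<A> N T \<longleftrightarrow>
    (\<exists>x. \<forall>V. (\<forall>s\<in>{1..N}. open (V s) \<and> V s \<noteq> {}) \<longrightarrow>
      {n\<in>{1..}. \<forall>s\<in>{1..N}. (T s ^^ n) x \<in> V s} \<in> \<A>)"

end

theory Submission
  imports Defs
begin

text \<open>
  Everything rests on the formula that the \<open>j\<close>-th coordinate of \<open>T\<^sup>n x\<close> is \<open>W\<^bsub>j,n\<^esub> x\<^bsub>f\<^sup>n(j)\<^esub>\<close>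
  (\<open>coord_iterate\<close>): an orbit at time \<open>n\<close> sees only the coordinates of \<open>x\<close> at the positions
  \<open>f\<^sup>n(j)\<close>.

  Necessity. Let \<open>x\<close> be a disjoint hypercyclic vector, and let \<open>A\<close> be the set of times \<open>n\<close> at which every
  \<open>T\<^sub>s\<^sup>n x\<close> is \<open>\<eta>\<close>-close to \<open>y\<^sub>s = \<Sum>\<^bsub>j\<le>l\<^esub> a\<^bsub>s,j\<^esub> e\<^sub>j\<close>. At such times \<open>W\<^sup>s\<^bsub>j,n\<^esub> x\<^bsub>f\<^sub>s\<^sup>n(j)\<^esub>\<close> is near
  \<open>a\<^bsub>s,j\<^esub>\<close> for \<open>j \<le> l\<close> and near \<open>0\<close> for \<open>j > l\<close>. Since \<open>x\<close> is a null sequence, the first estimate makes the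
  weights tend to infinity; two indices that share a position share the coordinate of \<open>x\<close> there, so it
  cancels from quotients and leaves the bounds on quotients of weights (\<open>weight_criterion_of_returns\<close>).

  Sufficiency. Conversely, if the criterion holds along \<open>A\<close>, then putting the value \<open>a\<^bsub>s,j\<^esub> / W\<^sup>s\<^bsub>j,n\<^esub>\<close> at the
  position \<open>f\<^sub>s\<^sup>n(j)\<close> for all late \<open>n \<in> A\<close> forces \<open>T\<^sub>s\<^sup>n\<close> close to \<open>y\<^sub>s\<close> at all these times. Almost partition
  regularity keeps different times from competing for a position; operators competing for a position at the same
  time make compatible demands by the third condition; the second condition bounds what values placed for
  one time do to the coordinates beyond \<open>l\<close> at another; and the first makes the values small, so
  that they perturb a given vector only slightly (\<open>simultaneous_perturbation\<close>). Thus near every vector there is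
  one that returns to the target with a density that depends on the target only, and a
  Baire category argument produces a single vector that serves all targets
  (\<open>Baire_common_return_point\<close>).
\<close>

section \<open>Positive density through windows\<close>

text \<open>
  Both families are captured by one notion: \<open>K\<close> is the set of admissible left end points of windows,
  \<open>{0}\<close> for the upper density and \<open>{1..}\<close> for the upper Banach density.
\<close>

definition dense_windows :: "nat set \<Rightarrow> real \<Rightarrow> nat set \<Rightarrow> bool"
  where "dense_windows K \<delta> A \<longleftrightarrow>
    (\<exists>\<^sub>F M in sequentially. \<exists>k\<in>K. \<delta> * real M < real (card (A \<inter> {k+1..k+M})))"

lemma limsup_pos_iff:
  fixes g :: "nat \<Rightarrow> nat"
  shows "limsup (\<lambda>M. ereal (real (g M) / real M)) > 0 \<longleftrightarrow>
    (\<exists>\<delta>>0. \<exists>\<^sub>F M in sequentially. \<delta> * real M < real (g M))"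
proof
  assume "limsup (\<lambda>M. ereal (real (g M) / real M)) > 0"
  then have "\<not> (\<forall>y>0. \<forall>\<^sub>F M in sequentially. ereal (real (g M) / real M) < y)"
    unfolding Limsup_le_iff[symmetric] not_le .
  then obtain y where y: "y > 0" "\<exists>\<^sub>F M in sequentially. y \<le> ereal (real (g M) / real M)"
    unfolding frequently_def not_le by blast
  obtain d where d: "0 < ereal d" "ereal d < y"
    using ereal_dense2[OF y(1)] by auto
  have "\<exists>\<^sub>F M in sequentially. d * real M < real (g M)"
    using y(2)
  proof (rule frequently_rev_mp)
    show "\<forall>\<^sub>F M in sequentially. y \<le> ereal (real (g M) / real M) \<longrightarrow> d * real M < real (g M)"
      using eventually_gt_at_top[of 0]
    proof eventually_elim
      case (elim M)
      show ?case
      proof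
        assume "y \<le> ereal (real (g M) / real M)"
        with d(2) have "ereal d < ereal (real (g M) / real M)"
          by (rule less_le_trans)
        then show "d * real M < real (g M)"
          using elim by (simp add: pos_less_divide_eq)
      qed
    qed
  qed
  then show "\<exists>\<delta>>0. \<exists>\<^sub>F M in sequentially. \<delta> * real M < real (g M)"
    using d(1) by auto
next
  assume "\<exists>\<delta>>0. \<exists>\<^sub>F M in sequentially. \<delta> * real M < real (g M)"
  then obtain d :: real where d: "d > 0" "\<exists>\<^sub>F M in sequentially. d * real M < real (g M)"
    by blast
  have "\<exists>\<^sub>F M in sequentially. ereal d \<le> ereal (real (g M) / real M)"
    using d(2)
  proof (rule frequently_rev_mp)
    show "\<forall>\<^sub>F M in sequentially. d * real M < real (g M) \<longrightarrow> ereal d \<le> ereal (real (g M) / real M)"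
      using eventually_gt_at_top[of 0] by eventually_elim (auto simp: field_simps)
  qed
  then have "\<not> limsup (\<lambda>M. ereal (real (g M) / real M)) \<le> 0"
    using d(1) unfolding Limsup_le_iff by (auto simp: not_eventually not_less intro!: exI[of _ "ereal d"])
  then show "limsup (\<lambda>M. ereal (real (g M) / real M)) > 0"
    by simp
qed

lemma A_ud_iff: "A \<in> A_ud \<longleftrightarrow> A \<subseteq> {1..} \<and> (\<exists>\<delta>>0. dense_windows {0} \<delta> A)"
  by (simp add: A_ud_def upper_density_def limsup_pos_iff dense_windows_def)

lemma A_uBd_iff: "A \<in> A_uBd \<longleftrightarrow> A \<subseteq> {1..} \<and> (\<exists>\<delta>>0. dense_windows {1..} \<delta> A)"
proof -
  have "\<delta> * real M < real (MAX k\<in>{1..}. card (A \<inter> {k+1..k+M})) \<longleftrightarrow>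
      (\<exists>k\<in>{1..}. \<delta> * real M < real (card (A \<inter> {k+1..k+M})))" for \<delta> M
  proof -
    let ?S = "(\<lambda>k. card (A \<inter> {k+1..k+M})) ` {1..}"
    have S: "finite ?S" "?S \<noteq> {}"
      by (rule finite_card_windows) simp
    show ?thesis
    proof
      assume "\<delta> * real M < real (Max ?S)"
      moreover have "Max ?S \<in> ?S" by (rule Max_in[OF S])
      ultimately show "\<exists>k\<in>{1..}. \<delta> * real M < real (card (A \<inter> {k+1..k+M}))"
        by (metis (no_types, lifting) imageE)
    next
      assume "\<exists>k\<in>{1..}. \<delta> * real M < real (card (A \<inter> {k+1..k+M}))"
      then obtain k where k: "k \<in> {1..}" "\<delta> * real M < real (card (A \<inter> {k+1..k+M}))" by blast
      have "card (A \<inter> {k+1..k+M}) \<le> Max ?S"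
        using k(1) by (intro Max_ge[OF S(1)] imageI)
      with k(2) show "\<delta> * real M < real (Max ?S)" by linarith
    qed
  qed
  then show ?thesis
    unfolding A_uBd_def upper_Banach_density_def limsup_pos_iff dense_windows_def mem_Collect_eq by presburger
qed

lemma dense_windows_mono:
  assumes "dense_windows K \<delta> A" "A \<subseteq> B"
  shows "dense_windows K \<delta> B"
  using assms(1) unfolding dense_windows_def
proof (rule frequently_elim1)
  fix M assume "\<exists>k\<in>K. \<delta> * real M < real (card (A \<inter> {k+1..k+M}))"
  moreover have "card (A \<inter> {k+1..k+M}) \<le> card (B \<inter> {k+1..k+M})" for k
    using assms(2) by (intro card_mono) auto
  ultimately show "\<exists>k\<in>K. \<delta> * real M < real (card (B \<inter> {k+1..k+M}))"
    by (meson of_nat_le_iff less_le_trans)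
qed

text \<open>
  Removing the times below \<open>p\<close> costs at most \<open>p\<close> elements per window, which is negligible for long windows.
  Halving \<open>\<delta>\<close> absorbs this uniformly in \<open>p\<close>; that the new bound does not depend on \<open>p\<close> is
  essential for the Baire argument.
\<close>

lemma dense_windows_tail:
  assumes "dense_windows K \<delta> A" "\<delta> > 0"
  shows "dense_windows K (\<delta> / 2) (A \<inter> {p..})"
  using assms(1) unfolding dense_windows_def
proof (rule frequently_rev_mp)
  show "\<forall>\<^sub>F M in sequentially. (\<exists>k\<in>K. \<delta> * real M < real (card (A \<inter> {k+1..k+M}))) \<longrightarrow>
      (\<exists>k\<in>K. \<delta> / 2 * real M < real (card (A \<inter> {p..} \<inter> {k+1..k+M})))"
    using eventually_ge_at_top[of "nat \<lceil>2 * real p / \<delta>\<rceil>"]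
  proof eventually_elim
    case (elim M)
    then have "2 * real p / \<delta> \<le> real M"
      using real_nat_ceiling_ge[of "2 * real p / \<delta>"] by linarith
    then have p: "real p \<le> \<delta> / 2 * real M"
      using assms(2) by (simp add: field_simps)
    have "card (A \<inter> {k+1..k+M}) \<le> card (A \<inter> {p..} \<inter> {k+1..k+M}) + p" for k
    proof -
      have "card (A \<inter> {k+1..k+M}) \<le> card (A \<inter> {p..} \<inter> {k+1..k+M} \<union> {..<p})"
        by (intro card_mono) auto
      also have "\<dots> \<le> card (A \<inter> {p..} \<inter> {k+1..k+M}) + card {..<p}"
        by (rule card_Un_le)
      finally show ?thesis by simp
    qed
    then have "real (card (A \<inter> {k+1..k+M})) \<le> real (card (A \<inter> {p..} \<inter> {k+1..k+M})) + real p" for k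
      by (metis of_nat_add of_nat_le_iff)
    moreover have "\<delta> * real M = \<delta> / 2 * real M + \<delta> / 2 * real M"
      by simp
    ultimately have "\<delta> / 2 * real M < real (card (A \<inter> {p..} \<inter> {k+1..k+M}))"
      if "\<delta> * real M < real (card (A \<inter> {k+1..k+M}))" for k
      using that p by (smt (verit))
    then show ?case by blast
  qed
qed

section \<open>A Baire category principle\<close>

definition return_times :: "nat \<Rightarrow> (nat \<Rightarrow> 'x \<Rightarrow> 'x) \<Rightarrow> (nat \<Rightarrow> 'x set) \<Rightarrow> 'x \<Rightarrow> nat set"
  where "return_times N T V x = {n\<in>{1..}. \<forall>s\<in>{1..N}. (T s ^^ n) x \<in> V s}"

lemma return_times_mono:
  "(\<And>s. s \<in> {1..N} \<Longrightarrow> V s \<subseteq> W s) \<Longrightarrow> return_times N T V x \<subseteq> return_times N T W x"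
  unfolding return_times_def by blast

lemma continuous_on_funpow:
  fixes T :: "'x::topological_space \<Rightarrow> 'x"
  assumes "continuous_on UNIV T"
  shows "continuous_on UNIV (T ^^ n)"
proof (induction n)
  case (Suc n)
  then show ?case
    using continuous_on_compose[OF Suc.IH, of T] assms by (auto intro: continuous_on_subset)
qed (simp add: id_def)

lemma open_window_hits:
  fixes T :: "nat \<Rightarrow> 'x::topological_space \<Rightarrow> 'x"
  assumes "\<And>s. s \<in> {1..N} \<Longrightarrow> continuous_on UNIV (T s)"
    and "\<And>s. s \<in> {1..N} \<Longrightarrow> open (V s)"
  shows "open {x. c < real (card (return_times N T V x \<inter> {k+1..k+M}))}"
proof (subst open_subopen, intro ballI)
  fix x assume x: "x \<in> {x. c < real (card (return_times N T V x \<inter> {k+1..k+M}))}"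
  define F where "F = return_times N T V x \<inter> {k+1..k+M}"
  define S where "S = (\<Inter>n\<in>F. \<Inter>s\<in>{1..N}. (T s ^^ n) -` V s)"
  have "finite F" by (simp add: F_def)
  then have "open S"
    unfolding S_def using assms
    by (intro open_INT ballI open_vimage continuous_on_funpow) auto
  moreover have "x \<in> S"
    by (auto simp: S_def F_def return_times_def)
  moreover have "S \<subseteq> {x. c < real (card (return_times N T V x \<inter> {k+1..k+M}))}"
  proof
    fix y assume "y \<in> S"
    then have "F \<subseteq> return_times N T V y \<inter> {k+1..k+M}"
      by (auto simp: S_def F_def return_times_def)
    then have "card F \<le> card (return_times N T V y \<inter> {k+1..k+M})"
      by (intro card_mono) auto
    with x show "y \<in> {x. c < real (card (return_times N T V x \<inter> {k+1..k+M}))}"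
      by (simp add: F_def)
  qed
  ultimately show "\<exists>S. open S \<and> x \<in> S \<and> S \<subseteq> {x. c < real (card (return_times N T V x \<inter> {k+1..k+M}))}"
    by blast
qed

text \<open>
  With a density bound \<open>\<delta> V\<close> that depends on the target \<open>V\<close> only, the points whose returns to \<open>V\<close> reach
  this bound form a countable intersection over \<open>m\<close> of the sets asking for some window of length at least
  \<open>m\<close> rich in returns. These sets are open, because a single window involves finitely many iterates, and
  dense by hypothesis, so one point serves all targets of a countable base at once.
\<close>

lemma Baire_common_return_point:
  fixes T :: "nat \<Rightarrow> 'x::complete_space \<Rightarrow> 'x" and \<V> :: "(nat \<Rightarrow> 'x set) set"
  assumes cont: "\<And>s. s \<in> {1..N} \<Longrightarrow> continuous_on UNIV (T s)"
    and "countable \<V>"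
    and open_target: "\<And>V s. V \<in> \<V> \<Longrightarrow> s \<in> {1..N} \<Longrightarrow> open (V s)"
    and base: "\<And>W. \<forall>s\<in>{1..N}. open (W s) \<and> W s \<noteq> {} \<Longrightarrow> \<exists>V\<in>\<V>. \<forall>s\<in>{1..N}. V s \<subseteq> W s"
    and hit: "\<And>V U. V \<in> \<V> \<Longrightarrow> open U \<Longrightarrow> U \<noteq> {} \<Longrightarrow> \<exists>x\<in>U. dense_windows K (\<delta> V) (return_times N T V x)"
  shows "\<exists>x. \<forall>W. (\<forall>s\<in>{1..N}. open (W s) \<and> W s \<noteq> {}) \<longrightarrow>
    (\<exists>V\<in>\<V>. dense_windows K (\<delta> V) (return_times N T W x))"
proof -
  define G where "G = (\<lambda>(V, m). \<Union>M\<in>{m..}. \<Union>k\<in>K.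
      {x. \<delta> V * real M < real (card (return_times N T V x \<inter> {k+1..k+M}))})"
  have dense_open: "open (G p) \<and> closure (G p) = UNIV" if p_mem: "p \<in> \<V> \<times> (UNIV::nat set)" for p
  proof -
    obtain V m where p: "p = (V, m)" "V \<in> \<V>"
      using p_mem by auto
    have "open (G p)"
      unfolding p G_def prod.case
      by (intro open_UN ballI open_window_hits cont open_target[OF p(2)])
    moreover have "G p \<inter> U \<noteq> {}" if "open U" "U \<noteq> {}" for U
    proof -
      obtain x where "x \<in> U" "dense_windows K (\<delta> V) (return_times N T V x)"
        using hit[OF p(2) \<open>open U\<close> \<open>U \<noteq> {}\<close>] by blast
      then have "x \<in> G p \<inter> U"
        by (fastforce simp: p G_def dense_windows_def frequently_sequentially)
      then show ?thesis by blast
    qed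
    then have "closure (G p) = UNIV"
      by (metis Compl_iff UNIV_eq_I closed_closure closure_subset disjoint_eq_subset_Compl
          empty_iff open_Compl Compl_subset_Compl_iff double_complement)
    ultimately show ?thesis by blast
  qed
  have "closure (\<Inter>(G ` (\<V> \<times> UNIV))) = (UNIV :: 'x set)"
  proof -
    have "euclidean closure_of \<Inter>(G ` (\<V> \<times> UNIV)) = topspace (euclidean :: 'x topology)"
    proof (rule Baire_category)
      show "countable (G ` (\<V> \<times> UNIV))"
        using \<open>countable \<V>\<close> by simp
      fix S assume "S \<in> G ` (\<V> \<times> UNIV)"
      then show "openin euclidean S \<and> euclidean closure_of S = topspace euclidean"
        using dense_open by force
    qed (simp add: completely_metrizable_space_euclidean)
    then show ?thesis by simp
  qed
  then have "\<Inter>(G ` (\<V> \<times> UNIV)) \<noteq> {}"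
    by (metis UNIV_not_empty closure_empty)
  then obtain x where x: "\<And>V m. V \<in> \<V> \<Longrightarrow> x \<in> G (V, m)"
    by auto
  have *: "dense_windows K (\<delta> V) (return_times N T V x)" if "V \<in> \<V>" for V
    unfolding dense_windows_def frequently_sequentially
    using x[OF that] by (fastforce simp: G_def)
  show ?thesis
  proof (intro exI[of _ x] allI impI)
    fix W :: "nat \<Rightarrow> 'x set" assume "\<forall>s\<in>{1..N}. open (W s) \<and> W s \<noteq> {}"
    from base[OF this] obtain V where V: "V \<in> \<V>" "\<forall>s\<in>{1..N}. V s \<subseteq> W s"
      by blast
    then have "return_times N T V x \<subseteq> return_times N T W x"
      by (intro return_times_mono) blast
    with * [OF V(1)] show "\<exists>V\<in>\<V>. dense_windows K (\<delta> V) (return_times N T W x)"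
      using V(1) dense_windows_mono by blast
  qed
qed

section \<open>Iterates of pseudo-shifts\<close>

context
  fixes f :: "nat \<Rightarrow> nat" and w :: "nat \<Rightarrow> 'a::real_normed_field"
  assumes data: "pseudo_shift_data f w"
begin

lemma index_gt: "j \<ge> 1 \<Longrightarrow> f j > j"
proof (induction j rule: nat_induct_at_least)
  case base
  show ?case using data by (simp add: pseudo_shift_data_def)
next
  case (Suc j)
  have "f j < f (Suc j)"
    using data Suc.hyps by (auto simp: pseudo_shift_data_def strict_mono_on_def)
  with Suc.IH show ?case by linarith
qed

lemma iterate_ge: "j \<ge> 1 \<Longrightarrow> (f ^^ n) j \<ge> j + n"
proof (induction n)
  case (Suc n)
  then show ?case using index_gt[of "(f ^^ n) j"] by simp
qed simp

lemma inj_on_iterate: "inj_on (f ^^ n) {1..}"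
proof (induction n)
  case (Suc n)
  have "inj_on f {1..}"
    using data by (auto simp: pseudo_shift_data_def intro: strict_mono_on_imp_inj_on)
  moreover have "(f ^^ n) ` {1..} \<subseteq> {1..}"
  proof
    fix i assume "i \<in> (f ^^ n) ` {1..}"
    then obtain j where "j \<ge> 1" "i = (f ^^ n) j" by auto
    then show "i \<in> {1..}" using iterate_ge[of j n] by simp
  qed
  ultimately show ?case
    using comp_inj_on[OF Suc.IH, of f] by (auto simp: o_def intro: inj_on_subset)
qed simp

lemma iter_inv_iterate: "j \<ge> 1 \<Longrightarrow> iter_inv f n ((f ^^ n) j) = j"
  unfolding iter_inv_def by (intro inv_into_f_f inj_on_iterate) simp

lemma coord_iterate:
  "j \<ge> 1 \<Longrightarrow> coord ((pseudo_shift f w ^^ n) x) j = weight_prod f w j n * coord x ((f ^^ n) j)"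
proof (induction n arbitrary: x)
  case 0
  then show ?case by (simp add: weight_prod_def)
next
  case (Suc n)
  have "(f ^^ n) j \<ge> 1" using iterate_ge[OF Suc.prems, of n] Suc.prems by simp
  then show ?case
    using Suc by (simp add: funpow_Suc_right coord_pseudo_shift[OF data] weight_prod_def
        del: funpow.simps) (simp add: funpow_swap1)
qed

lemma continuous_on_pseudo_shift: "continuous_on UNIV (pseudo_shift f w)"
proof -
  obtain B where B: "\<And>i. i \<ge> 1 \<Longrightarrow> norm (w i) \<le> B" "B > 0"
    using data by (auto simp: pseudo_shift_data_def bounded_pos)
  have "dist (pseudo_shift f w x) (pseudo_shift f w y) \<le> B * dist x y" for x y
    unfolding dist_norm
  proof (rule norm_c0_leI)
    fix j :: nat assume j: "j \<ge> 1"
    have "coord (pseudo_shift f w x - pseudo_shift f w y) j = w (f j) * coord (x - y) (f j)"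
      using j by (simp add: minus_c0.rep_eq coord_pseudo_shift[OF data] algebra_simps)
    moreover have "norm (w (f j)) \<le> B"
      using j index_gt[OF j] by (intro B) simp
    ultimately show "norm (coord (pseudo_shift f w x - pseudo_shift f w y) j) \<le> B * norm (x - y)"
      using B(2) by (auto simp: norm_mult intro!: mult_mono norm_coord_le)
  qed
  then have "B-lipschitz_on UNIV (pseudo_shift f w)"
    using B(2) by (intro lipschitz_onI) auto
  then show ?thesis by (rule lipschitz_on_continuous_on)
qed

end

section \<open>A countable base of finitely supported targets\<close>

definition fin_vec :: "nat \<Rightarrow> (nat \<Rightarrow> 'a) \<Rightarrow> 'a::real_normed_vector c0"
  where "fin_vec l b = Abs_c0 (\<lambda>j. if j \<in> {1..l} then b j else 0)"

lemma coord_fin_vec: "coord (fin_vec l b) j = (if j \<in> {1..l} then b j else 0)"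
proof -
  have "(\<lambda>j. if j \<in> {1..l} then b j else 0) \<longlonglongrightarrow> 0"
    by (rule tendsto_eventually, rule eventually_mono[OF eventually_gt_at_top[of l]]) simp
  then show ?thesis
    by (simp add: fin_vec_def Abs_c0_inverse)
qed

text \<open>
  Products of balls around vectors supported on a common \<open>{1..l}\<close>, with coefficients from a countable dense
  set of scalars. As the scalar field has no isolated points, \<open>0\<close> can be left out of that set, so the
  criterion, which concerns nonzero coefficients, applies to every member of the base.
\<close>

lemma countable_target_base:
  obtains \<V> :: "(nat \<Rightarrow> 'a::{real_normed_field, euclidean_space} c0 set) set"
  where "countable \<V>"
    and "\<And>V. V \<in> \<V> \<Longrightarrow> \<exists>l\<ge>1. \<exists>a. \<exists>r>0.
      (\<forall>s\<in>{1..N}. \<forall>j\<in>{1..l}. a s j \<noteq> 0) \<and> V = (\<lambda>s. ball (fin_vec l (a s)) r)"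
    and "\<And>W. \<forall>s\<in>{1..N}. open (W s) \<and> W s \<noteq> {} \<Longrightarrow> \<exists>V\<in>\<V>. \<forall>s\<in>{1..N}. V s \<subseteq> W s"
proof -
  obtain D :: "'a set" where D: "countable D" "\<And>X. open X \<Longrightarrow> X \<noteq> {} \<Longrightarrow> \<exists>d\<in>D. d \<in> X"
    using countable_dense_setE by blast
  define I where "I = (\<lambda>l::nat. PiE {1..N} (\<lambda>_. PiE {1..l} (\<lambda>_. D - {0})))"
  define \<V> :: "(nat \<Rightarrow> 'a c0 set) set" where "\<V> = (\<Union>l\<in>{1..}. \<Union>k. (\<lambda>a s. ball (fin_vec l (a s)) (inverse (real (Suc k)))) ` I l)"
  have "countable (I l)" for l
    unfolding I_def using D(1) by (intro countable_PiE) auto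
  then have "countable \<V>"
    unfolding \<V>_def by (intro countable_UN countable_image) auto
  moreover have "\<exists>l\<ge>1. \<exists>a. \<exists>r>0.
      (\<forall>s\<in>{1..N}. \<forall>j\<in>{1..l}. a s j \<noteq> 0) \<and> V = (\<lambda>s. ball (fin_vec l (a s)) r)" if "V \<in> \<V>" for V
  proof -
    from that obtain l k a where V: "l \<ge> 1" "a \<in> I l"
        "V = (\<lambda>s. ball (fin_vec l (a s)) (inverse (real (Suc k))))"
      unfolding \<V>_def by auto
    have "\<forall>s\<in>{1..N}. \<forall>j\<in>{1..l}. a s j \<noteq> 0"
      using V(2) unfolding I_def by (fastforce dest: PiE_mem)
    then show ?thesis
      using V(1,3) by (metis inverse_positive_iff_positive of_nat_0_less_iff zero_less_Suc)
  qed
  moreover have "\<exists>V\<in>\<V>. \<forall>s\<in>{1..N}. V s \<subseteq> W s" if W: "\<forall>s\<in>{1..N}. open (W s) \<and> W s \<noteq> {}" for W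
  proof -
    have "\<forall>s\<in>{1..N}. \<exists>z e. e > 0 \<and> ball z e \<subseteq> W s"
      using W by (meson ex_in_conv openE)
    then obtain z e where ze: "\<And>s. s \<in> {1..N} \<Longrightarrow> e s > 0 \<and> ball (z s) (e s) \<subseteq> W s"
      by metis
    define e0 where "e0 = Min (insert (1::real) (e ` {1..N}))"
    have e0: "e0 > 0"
      using ze by (auto simp: e0_def)
    have e0_le: "e0 \<le> e s" if "s \<in> {1..N}" for s
      unfolding e0_def using that by (intro Min_le) auto
    obtain k where k: "inverse (real (Suc k)) < e0 / 2"
      using reals_Archimedean[of "e0 / 2"] e0 by auto
    define r where "r = inverse (real (Suc k))"
    have r: "r > 0" "2 * r < e0" using k by (auto simp: r_def)
    have "\<forall>\<^sub>F j in sequentially. \<forall>s\<in>{1..N}. norm (coord (z s) j) < r"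
      by (intro eventually_ball_finite ballI order_tendstoD(2)[OF _ r(1)]
          tendsto_norm_zero coord_tendsto_0) simp
    then obtain l0 where l0: "\<And>j s. j \<ge> l0 \<Longrightarrow> s \<in> {1..N} \<Longrightarrow> norm (coord (z s) j) < r"
      unfolding eventually_sequentially by blast
    define l where "l = max 1 l0"
    have "\<exists>d\<in>D - {0}. dist (coord (z s) j) d < r" for s j
    proof -
      have "open (ball (coord (z s) j) r - {0})" by (intro open_delete) simp
      moreover have "ball (coord (z s) j) r - {0} \<noteq> {}"
      proof (cases "coord (z s) j = 0")
        case True
        then have "of_real (r / 2) \<in> ball (coord (z s) j) r - {0}"
          using r(1) by simp
        then show ?thesis by blast
      next
        case False
        then have "coord (z s) j \<in> ball (coord (z s) j) r - {0}"
          using r(1) by simp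
        then show ?thesis by blast
      qed
      ultimately obtain d where "d \<in> D" "d \<in> ball (coord (z s) j) r - {0}"
        using D(2) by blast
      then show ?thesis by auto
    qed
    then obtain b where b: "\<And>s j. b s j \<in> D - {0}" "\<And>s j. dist (coord (z s) j) (b s j) < r"
      by metis
    define a where "a = restrict (\<lambda>s. restrict (b s) {1..l}) {1..N}"
    have "a \<in> I l"
      using b(1) by (auto simp: I_def a_def)
    then have "(\<lambda>s. ball (fin_vec l (a s)) r) \<in> \<V>"
      unfolding \<V>_def r_def
      by (intro UN_I[of l] UN_I[of k] image_eqI[of _ _ a]) (simp_all add: l_def)
    moreover have "ball (fin_vec l (a s)) r \<subseteq> W s" if s: "s \<in> {1..N}" for s
    proof -
      have "norm (fin_vec l (a s) - z s) \<le> r"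
      proof (rule norm_c0_leI)
        fix j :: nat assume "j \<ge> 1"
        then show "norm (coord (fin_vec l (a s) - z s) j) \<le> r"
          using b(2)[of s j] l0[OF _ s, of j] s
          by (cases "j \<le> l")
            (auto simp: minus_c0.rep_eq coord_fin_vec a_def l_def dist_norm norm_minus_commute less_imp_le)
      qed
      then have "dist (z s) (fin_vec l (a s)) \<le> r"
        by (simp add: dist_norm norm_minus_commute)
      then have "dist (z s) v < e s" if "dist (fin_vec l (a s)) v < r" for v
        using r(2) e0_le[OF s] that dist_triangle[of "z s" v "fin_vec l (a s)"] by linarith
      then have "ball (fin_vec l (a s)) r \<subseteq> ball (z s) (e s)"
        by auto
      then show ?thesis using ze[OF s] by blast
    qed
    ultimately show ?thesis by (intro bexI) auto
  qed
  ultimately show thesis by (rule that)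
qed

section \<open>From returns to the weight criterion\<close>

definition weight_criterion ::
    "nat \<Rightarrow> (nat \<Rightarrow> nat \<Rightarrow> nat) \<Rightarrow> (nat \<Rightarrow> nat \<Rightarrow> 'a::real_normed_field) \<Rightarrow>
      nat \<Rightarrow> (nat \<Rightarrow> nat \<Rightarrow> 'a) \<Rightarrow> real \<Rightarrow> nat set \<Rightarrow> bool"
  where "weight_criterion N f w l a \<epsilon> A \<longleftrightarrow>
        (\<forall>j\<in>{1..l}. \<forall>s\<in>{1..N}.
          filterlim (\<lambda>n. norm (weight_prod (f s) (w s) j n)) at_top
            (inf sequentially (principal A))) \<and>
        (\<forall>j\<in>{1..l}. \<forall>n\<in>A. \<forall>s\<in>{1..N}. \<forall>t\<in>{1..N}. \<forall>m\<in>A.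
          (f t ^^ m) j \<in> (f s ^^ n) ` {l<..} \<longrightarrow>
          norm (weight_prod (f s) (w s) (iter_inv (f s) n ((f t ^^ m) j)) n)
            / norm (weight_prod (f t) (w t) j m) \<le> \<epsilon>) \<and>
        (\<forall>n\<in>A. \<forall>s\<in>{1..N}. \<forall>t\<in>{1..N}. s \<noteq> t \<longrightarrow>
          (\<forall>j\<in>(f t ^^ n) ` {1..l} \<inter> (f s ^^ n) ` {1..l}.
            norm (weight_prod (f s) (w s) (iter_inv (f s) n j) n
                    / weight_prod (f t) (w t) (iter_inv (f t) n j) n
                  - a s (iter_inv (f s) n j) / a t (iter_inv (f t) n j)) \<le> \<epsilon>))"

text \<open>
  Each clause is universal in the times or a limit along them, so passing to the subset supplied by almost
  partition regularity is harmless.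
\<close>

lemma weight_criterion_subset:
  assumes "weight_criterion N f w l a \<epsilon> B" "A \<subseteq> B"
  shows "weight_criterion N f w l a \<epsilon> A"
proof -
  have "inf sequentially (principal A) \<le> inf sequentially (principal B)"
    using assms(2) by (intro inf_mono) auto
  then show ?thesis
    using assms unfolding weight_criterion_def by (meson filterlim_mono order_refl subsetD)
qed

text \<open>
  Abbreviate \<open>p = W\<^sup>s\<^bsub>j,n\<^esub> x\<^sub>i\<close> with \<open>i = f\<^sub>s\<^sup>n(j)\<close>. For \<open>j \<le> l\<close> it is \<open>\<eta>\<close>-close to \<open>a\<^bsub>s,j\<^esub>\<close>, hence of modulus at
  least \<open>c\<close>; for \<open>j > l\<close> its modulus is at most \<open>\<eta>\<close>. All three conditions compare two such
  quantities at the same \<open>i\<close>, so the unknown \<open>x\<^sub>i\<close> drops out. The three bounds on \<open>\<eta>\<close>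
  serve the lower bound \<open>c\<close>, the tail condition and the quotient condition, in this order.
\<close>

lemma weight_criterion_of_returns:
  fixes f :: "nat \<Rightarrow> nat \<Rightarrow> nat" and w :: "nat \<Rightarrow> nat \<Rightarrow> 'a::real_normed_field"
  assumes data: "\<And>s. s \<in> {1..N} \<Longrightarrow> pseudo_shift_data (f s) (w s)"
    and c: "c > 0" "\<And>s j. s \<in> {1..N} \<Longrightarrow> j \<in> {1..l} \<Longrightarrow> 2 * c \<le> norm (a s j)"
    and C: "\<And>s j. s \<in> {1..N} \<Longrightarrow> j \<in> {1..l} \<Longrightarrow> norm (a s j) \<le> C"
    and \<eta>: "\<eta> \<le> c" "\<eta> \<le> \<epsilon> * c" "\<eta> * C \<le> \<epsilon> * c\<^sup>2" and "\<epsilon> > 0"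
  shows "weight_criterion N f w l a \<epsilon>
    (return_times N (\<lambda>s. pseudo_shift (f s) (w s)) (\<lambda>s. ball (fin_vec l (a s)) \<eta>) x)"
proof -
  define A where "A = return_times N (\<lambda>s. pseudo_shift (f s) (w s)) (\<lambda>s. ball (fin_vec l (a s)) \<eta>) x"
  define W where "W = (\<lambda>s. weight_prod (f s) (w s))"
  have near: "norm (W s j n * coord x ((f s ^^ n) j) - (if j \<in> {1..l} then a s j else 0)) < \<eta>"
    if "n \<in> A" "s \<in> {1..N}" "j \<ge> 1" for n s j
  proof -
    let ?y = "(pseudo_shift (f s) (w s) ^^ n) x"
    have "norm (?y - fin_vec l (a s)) < \<eta>"
      using that(1,2) by (auto simp: A_def return_times_def dist_norm norm_minus_commute)
    moreover have "norm (coord (?y - fin_vec l (a s)) j) \<le> norm (?y - fin_vec l (a s))"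
      by (rule norm_coord_le)
    ultimately show ?thesis
      using that by (simp add: minus_c0.rep_eq coord_fin_vec coord_iterate[OF data] W_def)
  qed
  have big: "c \<le> norm (W s j n * coord x ((f s ^^ n) j))"
    if "n \<in> A" "s \<in> {1..N}" "j \<in> {1..l}" for n s j
    using near[OF that(1,2), of j] c(2)[OF that(2,3)] \<eta>(1) that(3)
      norm_triangle_ineq2[of "a s j" "W s j n * coord x ((f s ^^ n) j)"]
    by (simp add: norm_minus_commute)
  have "filterlim (\<lambda>n. norm (W s j n)) at_top (inf sequentially (principal A))"
    if "j \<in> {1..l}" "s \<in> {1..N}" for j s
  proof (subst filterlim_at_top_gt[where c = 0], intro allI impI)
    fix Z :: real assume "Z > 0"
    have "filterlim (\<lambda>n. (f s ^^ n) j) sequentially sequentially"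
      using iterate_ge[OF data[OF that(2)], of j] that(1)
      by (intro filterlim_at_top_mono[OF filterlim_ident]) (auto intro!: always_eventually intro: add_leD2)
    then have "(\<lambda>n. norm (coord x ((f s ^^ n) j))) \<longlonglongrightarrow> 0"
      by (intro tendsto_norm_zero filterlim_compose[OF coord_tendsto_0])
    then have "\<forall>\<^sub>F n in sequentially. norm (coord x ((f s ^^ n) j)) < c / Z"
      using c(1) \<open>Z > 0\<close> by (intro order_tendstoD) auto
    (* the moduli of the weight products are at least c divided by a null sequence *)
    then show "\<forall>\<^sub>F n in inf sequentially (principal A). Z \<le> norm (W s j n)"
      unfolding eventually_inf_principal
    proof (rule eventually_mono, intro impI)
      fix n assume n: "norm (coord x ((f s ^^ n) j)) < c / Z" "n \<in> A"
      have "Z * norm (coord x ((f s ^^ n) j)) \<le> c"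
        using n(1) \<open>Z > 0\<close> by (simp add: field_simps)
      also have "c \<le> norm (W s j n) * norm (coord x ((f s ^^ n) j))"
        using big[OF n(2) that(2,1)] by (simp add: norm_mult)
      finally have "Z * norm (coord x ((f s ^^ n) j)) \<le> norm (W s j n) * norm (coord x ((f s ^^ n) j))" .
      moreover have "norm (coord x ((f s ^^ n) j)) > 0"
        using big[OF n(2) that(2,1)] c(1) by auto
      ultimately show "Z \<le> norm (W s j n)" by simp
    qed
  qed
  moreover have "norm (W s (iter_inv (f s) n ((f t ^^ m) j)) n) / norm (W t j m) \<le> \<epsilon>"
    if "j \<in> {1..l}" "n \<in> A" "s \<in> {1..N}" "t \<in> {1..N}" "m \<in> A" and tail: "(f t ^^ m) j \<in> (f s ^^ n) ` {l<..}"
    for j n s t m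
  proof -
    obtain k where k: "k > l" "(f t ^^ m) j = (f s ^^ n) k"
      using tail by auto
    define X where "X = norm (coord x ((f t ^^ m) j))"
    have t: "c \<le> norm (W t j m) * X"
      using big[OF that(5,4,1)] by (simp add: norm_mult X_def)
    have "norm (W s k n) * X \<le> \<eta>"
      using near[OF that(2,3), of k] k by (simp add: X_def norm_mult)
    also have "\<eta> \<le> \<epsilon> * (norm (W t j m) * X)"
      using \<eta>(2) mult_left_mono[OF t, of \<epsilon>] \<open>\<epsilon> > 0\<close> by linarith
    finally have "norm (W s k n) * X \<le> \<epsilon> * norm (W t j m) * X" by (simp add: mult.assoc)
    moreover have "X > 0" "norm (W t j m) > 0"
      using t c(1) by (auto simp: X_def)
    ultimately show ?thesis
      using k iter_inv_iterate[OF data[OF that(3)], of k n] by (simp add: field_simps)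
  qed
  moreover have "norm (W s (iter_inv (f s) n i) n / W t (iter_inv (f t) n i) n
        - a s (iter_inv (f s) n i) / a t (iter_inv (f t) n i)) \<le> \<epsilon>"
    if "n \<in> A" "s \<in> {1..N}" "t \<in> {1..N}" and i: "i \<in> (f t ^^ n) ` {1..l} \<inter> (f s ^^ n) ` {1..l}" for n s t i
  proof -
    obtain j k where jk: "j \<in> {1..l}" "k \<in> {1..l}" "i = (f s ^^ n) j" "i = (f t ^^ n) k"
      using i by auto
    have inv: "iter_inv (f s) n i = j" "iter_inv (f t) n i = k"
      using jk(1,2) iter_inv_iterate[OF data[OF that(2)], of j n] iter_inv_iterate[OF data[OF that(3)], of k n]
      unfolding jk(3)[symmetric] jk(4)[symmetric] by auto
    define p where "p = W s j n * coord x i"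
    define q where "q = W t k n * coord x i"
    have p: "norm (p - a s j) \<le> \<eta>" and q: "norm (q - a t k) \<le> \<eta>"
      using near[OF that(1,2), of j] near[OF that(1,3), of k] jk(1,2)
      by (simp_all add: p_def q_def flip: jk(3,4))
    have q': "c \<le> norm q" using big[OF that(1,3) jk(2)] by (simp add: q_def flip: jk(4))
    have nz: "q \<noteq> 0" "a t k \<noteq> 0" "coord x i \<noteq> 0" "W t k n \<noteq> 0"
      using q' c(1) c(2)[OF that(3) jk(2)] by (auto simp: q_def)
    have "W s j n / W t k n - a s j / a t k = p / q - a s j / a t k"
      using nz by (simp add: p_def q_def)
    also have "\<dots> = ((p - a s j) * a t k - a s j * (q - a t k)) / (q * a t k)"
      using nz by (simp add: field_simps)
    also have "norm \<dots> \<le> \<epsilon>"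
    proof -
      have "norm ((p - a s j) * a t k - a s j * (q - a t k)) \<le> norm (p - a s j) * norm (a t k) + norm (a s j) * norm (q - a t k)"
        by (rule order_trans[OF norm_triangle_ineq4]) (simp add: norm_mult)
      also have "\<dots> \<le> \<eta> * C + C * \<eta>"
        using p q C[OF that(2) jk(1)] C[OF that(3) jk(2)]
        by (intro add_mono mult_mono) (auto intro: order_trans[OF norm_ge_zero])
      also have "\<dots> \<le> \<epsilon> * (c * (2 * c))"
        using \<eta>(3) by (simp add: power2_eq_square algebra_simps)
      also have "\<dots> \<le> \<epsilon> * norm (q * a t k)"
        using q' c(1) c(2)[OF that(3) jk(2)] \<open>\<epsilon> > 0\<close>
        by (auto simp: norm_mult intro!: mult_left_mono mult_mono)
      finally show ?thesis
        using nz by (simp add: norm_divide field_simps)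
    qed
    finally show ?thesis unfolding inv .
  qed
  ultimately show ?thesis
    unfolding weight_criterion_def A_def[symmetric] W_def by blast
qed

lemma weight_criterion_of_hypercyclic:
  fixes f :: "nat \<Rightarrow> nat \<Rightarrow> nat" and w :: "nat \<Rightarrow> nat \<Rightarrow> 'a::real_normed_field"
  assumes data: "\<And>s. s \<in> {1..N} \<Longrightarrow> pseudo_shift_data (f s) (w s)"
    and hc: "disjoint_hypercyclic \<A> N (\<lambda>s. pseudo_shift (f s) (w s))"
    and nz: "\<forall>s\<in>{1..N}. \<forall>j\<in>{1..l}. a s j \<noteq> 0" and "\<epsilon> > 0"
  shows "\<exists>A\<in>\<A>. weight_criterion N f w l a \<epsilon> A"
proof -
  define S where "S = (\<lambda>(s, j). norm (a s j)) ` ({1..N} \<times> {1..l})"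
  have S: "finite S" "\<And>y. y \<in> S \<Longrightarrow> y > 0"
    using nz by (auto simp: S_def)
  define c where "c = Min (insert 1 S) / 2"
  define C where "C = Max (insert 1 S)"
  have c: "c > 0" and C: "C > 0"
    using S by (auto simp: c_def C_def Max_gr_iff)
  have bounds: "2 * c \<le> norm (a s j)" "norm (a s j) \<le> C" if "s \<in> {1..N}" "j \<in> {1..l}" for s j
  proof -
    have "norm (a s j) \<in> S" using that by (auto simp: S_def)
    then show "2 * c \<le> norm (a s j)" "norm (a s j) \<le> C"
      using S(1) by (auto simp: c_def C_def)
  qed
  define \<eta> where "\<eta> = min c (min (\<epsilon> * c) (\<epsilon> * c\<^sup>2 / C))"
  have \<eta>: "\<eta> > 0" "\<eta> \<le> c" "\<eta> \<le> \<epsilon> * c" "\<eta> \<le> \<epsilon> * c\<^sup>2 / C"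
    using c C \<open>\<epsilon> > 0\<close> by (auto simp: \<eta>_def)
  from hc obtain x where x: "\<And>V. \<forall>s\<in>{1..N}. open (V s) \<and> V s \<noteq> {} \<Longrightarrow>
      return_times N (\<lambda>s. pseudo_shift (f s) (w s)) V x \<in> \<A>"
    unfolding disjoint_hypercyclic_def return_times_def by blast
  have "return_times N (\<lambda>s. pseudo_shift (f s) (w s)) (\<lambda>s. ball (fin_vec l (a s)) \<eta>) x \<in> \<A>"
    using \<eta>(1) by (intro x) auto
  moreover have "weight_criterion N f w l a \<epsilon>
      (return_times N (\<lambda>s. pseudo_shift (f s) (w s)) (\<lambda>s. ball (fin_vec l (a s)) \<eta>) x)"
  proof (rule weight_criterion_of_returns[where c = c and C = C])
    show "\<eta> * C \<le> \<epsilon> * c\<^sup>2"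
      using \<eta>(4) C by (simp add: field_simps)
  qed (use data c bounds \<eta> \<open>\<epsilon> > 0\<close> in auto)
  ultimately show ?thesis by blast
qed

section \<open>From the weight criterion to hypercyclicity\<close>

text \<open>
  Keep \<open>x0\<close> on an initial segment of positions, erase its small tail, and at every position
  \<open>f\<^sub>s\<^sup>n(j)\<close> with \<open>n \<in> A\<close> late, \<open>j \<le> l\<close>, place the value \<open>a\<^bsub>s,j\<^esub> / W\<^sup>s\<^bsub>j,n\<^esub>\<close> that \<open>T\<^sub>s\<^sup>n\<close> carries to
  \<open>a\<^bsub>s,j\<^esub>\<close>. By disjointness a position determines \<open>n\<close>, and \<open>j\<close> once \<open>s\<close> is known; if several \<open>s\<close> claim it, any one of them is
  obeyed, and the others see an error of at most \<open>C * \<epsilon>\<close>.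
\<close>

lemma simultaneous_perturbation:
  fixes f :: "nat \<Rightarrow> nat \<Rightarrow> nat" and w :: "nat \<Rightarrow> nat \<Rightarrow> 'a::real_normed_field"
  assumes data: "\<And>s. s \<in> {1..N} \<Longrightarrow> pseudo_shift_data (f s) (w s)"
    and crit: "weight_criterion N f w l a \<epsilon> A"
    and disj: "\<forall>m\<in>A. \<forall>n\<in>A. m \<noteq> n \<longrightarrow>
        (\<forall>s\<in>{1..N}. \<forall>t\<in>{1..N}. (f s ^^ m) ` {1..l} \<inter> (f t ^^ n) ` {1..l} = {})"
    and C: "C > 0" "\<And>s j. s \<in> {1..N} \<Longrightarrow> j \<in> {1..l} \<Longrightarrow> norm (a s j) \<le> C"
    and nz: "\<forall>s\<in>{1..N}. \<forall>j\<in>{1..l}. a s j \<noteq> 0"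
    and "\<epsilon> > 0" "\<eta> > 0"
  obtains x p where "dist x0 x < \<eta>"
    and "\<And>n s. n \<in> A \<Longrightarrow> n \<ge> p \<Longrightarrow> s \<in> {1..N} \<Longrightarrow>
      dist (fin_vec l (a s)) ((pseudo_shift (f s) (w s) ^^ n) x) \<le> C * \<epsilon>"
proof -
  define W where "W = (\<lambda>s. weight_prod (f s) (w s))"
  have large: "\<exists>q. \<forall>n\<ge>q. n \<in> A \<longrightarrow>
      (\<forall>s\<in>{1..N}. \<forall>j\<in>{1..l}. W s j n \<noteq> 0 \<and> norm (a s j / W s j n) < r)" if "r > 0" for r
  proof -
    have "\<forall>\<^sub>F n in inf sequentially (principal A). \<forall>s\<in>{1..N}. \<forall>j\<in>{1..l}. C / r < norm (W s j n)"
      using crit unfolding weight_criterion_def W_def filterlim_at_top_dense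
      by (intro eventually_ball_finite ballI) auto
    then obtain q where q: "\<And>n s j. n \<ge> q \<Longrightarrow> n \<in> A \<Longrightarrow> s \<in> {1..N} \<Longrightarrow> j \<in> {1..l} \<Longrightarrow> C / r < norm (W s j n)"
      unfolding eventually_inf_principal eventually_sequentially by blast
    have "W s j n \<noteq> 0 \<and> norm (a s j / W s j n) < r"
      if "n \<ge> q" "n \<in> A" "s \<in> {1..N}" "j \<in> {1..l}" for n s j
    proof -
      have *: "C / r < norm (W s j n)" using q that by blast
      then have "norm (W s j n) > 0"
        using C(1) \<open>r > 0\<close> by (meson divide_pos_pos less_trans)
      moreover have "norm (a s j) < r * norm (W s j n)"
        using * C(2)[OF that(3,4)] \<open>r > 0\<close> by (simp add: field_simps)
      ultimately show ?thesis by (simp add: norm_divide field_simps)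
    qed
    then show ?thesis by blast
  qed
  have "\<forall>\<^sub>F i in sequentially. norm (coord x0 i) < \<eta> / 3"
    using \<open>\<eta> > 0\<close> tendsto_norm_zero[OF coord_tendsto_0] by (intro order_tendstoD) auto
  then obtain L where L: "\<And>i. i \<ge> L \<Longrightarrow> norm (coord x0 i) < \<eta> / 3"
    by (auto simp: eventually_sequentially)
  obtain q where q: "\<And>n s j. n \<ge> q \<Longrightarrow> n \<in> A \<Longrightarrow> s \<in> {1..N} \<Longrightarrow> j \<in> {1..l} \<Longrightarrow>
      W s j n \<noteq> 0 \<and> norm (a s j / W s j n) < \<eta> / 3"
    using large[OF divide_pos_pos[OF \<open>\<eta> > 0\<close>, of 3]] zero_less_numeral by blast
  define p where "p = max q L"
  (* P i (n, s, j): at time n, operator s claims position i for coordinate j *)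
  define P where "P = (\<lambda>i (n, s, j). n \<in> A \<and> n \<ge> p \<and> s \<in> {1..N} \<and> j \<in> {1..l} \<and> (f s ^^ n) j = i)"
  define c where "c = (\<lambda>i. if \<exists>z. P i z then case SOME z. P i z of (n, s, j) \<Rightarrow> a s j / W s j n
      else if i < L then coord x0 i else 0)"
  have c_choice: "\<exists>n s j. P i (n, s, j) \<and> c i = a s j / W s j n" if "P i z" for i z
  proof -
    obtain n s j where nsj: "(SOME z. P i z) = (n, s, j)"
      by (cases "SOME z. P i z") auto
    have "P i (n, s, j)"
      using someI[of "P i", OF that] nsj by simp
    moreover have "c i = a s j / W s j n"
      unfolding c_def if_P[OF exI[of "P i", OF that]] nsj by simp
    ultimately show ?thesis by blast
  qed
  (* late claims lie beyond the segment on which x0 is kept, because f^n(j) >= j + n *)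
  have P_ge: "i \<ge> L \<and> i \<ge> 1" if "P i (n, s, j)" for i n s j
    using that iterate_ge[OF data, of s j n] by (auto simp: P_def p_def)
  have c0: "c 0 = 0"
    using P_ge[of 0] by (auto simp: c_def)
  have "c \<longlonglongrightarrow> 0"
  proof (rule LIMSEQ_I)
    fix r :: real assume "r > 0"
    then obtain q' where q': "\<And>n s j. n \<ge> q' \<Longrightarrow> n \<in> A \<Longrightarrow> s \<in> {1..N} \<Longrightarrow> j \<in> {1..l} \<Longrightarrow>
        norm (a s j / W s j n) < r"
      using large[of r] by blast
    (* the finitely many claims of times below q' are confined to positions below some b *)
    have "finite (\<Union>n\<in>{..<q'}. \<Union>s\<in>{1..N}. (f s ^^ n) ` {1..l})" by simp
    then obtain b where b: "\<And>n s j. n < q' \<Longrightarrow> s \<in> {1..N} \<Longrightarrow> j \<in> {1..l} \<Longrightarrow> (f s ^^ n) j < b"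
      unfolding finite_nat_set_iff_bounded by blast
    have "norm (c i - 0) < r" if i: "i \<ge> max b L" for i
    proof (cases "\<exists>z. P i z")
      case True
      then obtain n s j where nsj: "P i (n, s, j)" "c i = a s j / W s j n"
        using c_choice by blast
      then have "n \<ge> q'"
        using b[of n s j] i by (auto simp: P_def not_less[symmetric])
      then show ?thesis using nsj q'[of n s j] by (auto simp: P_def)
    qed (use i \<open>r > 0\<close> in \<open>auto simp: c_def\<close>)
    then show "\<exists>no. \<forall>i\<ge>no. norm (c i - 0) < r" by blast
  qed
  define x where "x = Abs_c0 c"
  have coord_x: "coord x = c"
    unfolding x_def using \<open>c \<longlonglongrightarrow> 0\<close> c0 by (simp add: Abs_c0_inverse)
  have "norm (x0 - x) \<le> 2 * \<eta> / 3"
  proof (rule norm_c0_leI)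
    fix i :: nat
    have "norm (coord x0 i - c i) \<le> 2 * \<eta> / 3"
    proof (cases "\<exists>z. P i z")
      case True
      then obtain n s j where nsj: "P i (n, s, j)" "c i = a s j / W s j n"
        using c_choice by blast
      have "norm (c i) < \<eta> / 3"
        using nsj q[of n s j] by (auto simp: P_def p_def)
      then show ?thesis
        using L[of i] P_ge[OF nsj(1)] norm_triangle_ineq4[of "coord x0 i" "c i"] by auto
    next
      case False
      then show ?thesis using L[of i] \<open>\<eta> > 0\<close> by (auto simp: c_def)
    qed
    then show "norm (coord (x0 - x) i) \<le> 2 * \<eta> / 3"
      by (simp add: minus_c0.rep_eq coord_x)
  qed
  then have "dist x0 x < \<eta>" using \<open>\<eta> > 0\<close> by (simp add: dist_norm)
  moreover have "dist (fin_vec l (a s)) ((pseudo_shift (f s) (w s) ^^ n) x) \<le> C * \<epsilon>"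
    if n: "n \<in> A" "n \<ge> p" and s: "s \<in> {1..N}" for n s
    unfolding dist_norm norm_minus_commute[of "fin_vec l (a s)"]
  proof (rule norm_c0_leI)
    fix j :: nat assume j: "j \<ge> 1"
    define i where "i = (f s ^^ n) j"
    have i_ge: "i \<ge> L" using iterate_ge[OF data[OF s] j, of n] n(2) by (simp add: i_def p_def)
    have "norm (W s j n * c i - (if j \<in> {1..l} then a s j else 0)) \<le> C * \<epsilon>"
    proof (cases "j \<le> l")
      case True
      then have "P i (n, s, j)" using n s j by (simp add: P_def i_def)
      then obtain m t k where mtk: "P i (m, t, k)" "c i = a t k / W t k m"
        using c_choice by blast
      then have tk: "m \<in> A" "t \<in> {1..N}" "k \<in> {1..l}" "(f t ^^ m) k = i" "m \<ge> p"
        by (auto simp: P_def)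
      have j_mem: "j \<in> {1..l}" using True j by simp
      have "i \<in> (f t ^^ m) ` {1..l} \<inter> (f s ^^ n) ` {1..l}"
        using tk(3,4) j_mem i_def by blast
      with disj n(1) s tk(1,2) have [simp]: "m = n" by (metis empty_iff)
      have W_nz: "W t k n \<noteq> 0" using q[of n t k] tk by (simp add: p_def)
      show ?thesis
      proof (cases "t = s")
        case [simp]: True
        have "k = j"
          using tk(3,4) j inj_onD[OF inj_on_iterate[OF data[OF s], of n], of k j]
          by (simp add: i_def)
        then show ?thesis
          using mtk(2) W_nz j_mem C(1) \<open>\<epsilon> > 0\<close> by simp
      next
        case False
        have inv: "iter_inv (f s) n i = j" "iter_inv (f t) n i = k"
          using iter_inv_iterate[OF data[OF s] j, of n] iter_inv_iterate[OF data[OF tk(2)], of k n] tk(3,4)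
          by (auto simp: i_def)
        have ratio: "norm (W s j n / W t k n - a s j / a t k) \<le> \<epsilon>"
          using crit False s tk(2) n(1) \<open>i \<in> _\<close> inv unfolding weight_criterion_def W_def
          by (metis \<open>m = n\<close>)
        have "W s j n * c i - a s j = a t k * (W s j n / W t k n - a s j / a t k)"
          using nz tk(2,3) mtk(2) by (simp add: field_simps)
        then have "norm (W s j n * c i - a s j) \<le> C * \<epsilon>"
          using ratio C(2)[OF tk(2,3)] C(1) by (auto simp: norm_mult intro!: mult_mono)
        then show ?thesis using j_mem by simp
      qed
    next
      case False
      show ?thesis
      proof (cases "\<exists>z. P i z")
        case True
        then obtain m t k where mtk: "P i (m, t, k)" "c i = a t k / W t k m"
          using c_choice by blast
        then have tk: "m \<in> A" "t \<in> {1..N}" "k \<in> {1..l}" "(f t ^^ m) k = i"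
          by (auto simp: P_def)
        have "(f t ^^ m) k \<in> (f s ^^ n) ` {l<..}" "iter_inv (f s) n ((f t ^^ m) k) = j"
          using False iter_inv_iterate[OF data[OF s] j, of n] unfolding tk(4) by (auto simp: i_def)
        then have ratio: "norm (W s j n) / norm (W t k m) \<le> \<epsilon>"
          using crit tk(1-3) n(1) s unfolding weight_criterion_def W_def by metis
        have "norm (W s j n * c i) = norm (a t k) * (norm (W s j n) / norm (W t k m))"
          by (simp add: mtk(2) norm_mult norm_divide)
        also have "\<dots> \<le> C * \<epsilon>"
          using ratio C(2)[OF tk(2,3)] C(1) by (intro mult_mono) auto
        finally show ?thesis using False by simp
      next
        case no: False
        then have "c i = 0" using i_ge by (simp add: c_def)
        then show ?thesis using False C(1) \<open>\<epsilon> > 0\<close> by simp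
      qed
    qed
    then show "norm (coord ((pseudo_shift (f s) (w s) ^^ n) x - fin_vec l (a s)) j) \<le> C * \<epsilon>"
      using j by (simp add: minus_c0.rep_eq coord_fin_vec coord_iterate[OF data[OF s]] coord_x W_def i_def)
  qed
  ultimately show thesis by (rule that)
qed

text \<open>
  The set \<open>A\<close> is chosen from the target alone, before the open set \<open>U\<close>; the centre and size of \<open>U\<close>
  only decide how long an initial part of \<open>A\<close> is lost. This is why one \<open>\<delta>\<close> works for all \<open>U\<close>.
\<close>

lemma dense_returns_near_every_point:
  fixes f :: "nat \<Rightarrow> nat \<Rightarrow> nat" and w :: "nat \<Rightarrow> nat \<Rightarrow> 'a::real_normed_field"
  assumes data: "\<And>s. s \<in> {1..N} \<Longrightarrow> pseudo_shift_data (f s) (w s)"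
    and \<A>: "\<And>A. A \<in> \<A> \<longleftrightarrow> A \<subseteq> {1..} \<and> (\<exists>\<delta>>0. dense_windows K \<delta> A)"
    and apr: "almost_partition_regular \<A> N f"
    and crit: "\<And>\<epsilon>. \<epsilon> > 0 \<Longrightarrow> \<exists>A\<in>\<A>. weight_criterion N f w l a \<epsilon> A"
    and nz: "\<forall>s\<in>{1..N}. \<forall>j\<in>{1..l}. a s j \<noteq> 0"
    and "l \<ge> 1" "r > 0"
  shows "\<exists>\<delta>>0. \<forall>U. open U \<and> U \<noteq> {} \<longrightarrow> (\<exists>x\<in>U. dense_windows K \<delta>
    (return_times N (\<lambda>s. pseudo_shift (f s) (w s)) (\<lambda>s. ball (fin_vec l (a s)) r) x))"
proof -
  define C where "C = Max (insert 1 ((\<lambda>(s, j). norm (a s j)) ` ({1..N} \<times> {1..l})))"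
  have C: "C > 0"
    by (simp add: C_def Max_gr_iff)
  have a_le: "norm (a s j) \<le> C" if "s \<in> {1..N}" "j \<in> {1..l}" for s j
    unfolding C_def using that by (intro Max_ge) auto
  define \<epsilon> where "\<epsilon> = r / (2 * C)"
  have \<epsilon>: "\<epsilon> > 0" "C * \<epsilon> < r"
    using C \<open>r > 0\<close> by (auto simp: \<epsilon>_def)
  obtain B where B: "B \<in> \<A>" "weight_criterion N f w l a \<epsilon> B"
    using crit[OF \<epsilon>(1)] by blast
  obtain A where A: "A \<in> \<A>" "A \<subseteq> B" and disj: "\<forall>m\<in>A. \<forall>n\<in>A. m \<noteq> n \<longrightarrow>
      (\<forall>s\<in>{1..N}. \<forall>t\<in>{1..N}. (f s ^^ m) ` {1..l} \<inter> (f t ^^ n) ` {1..l} = {})"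
    using apr B(1) \<open>l \<ge> 1\<close> unfolding almost_partition_regular_def by blast
  obtain \<delta> where \<delta>: "\<delta> > 0" "dense_windows K \<delta> A" "A \<subseteq> {1..}"
    using A(1) \<A> by blast
  have "\<exists>x\<in>U. dense_windows K (\<delta> / 2)
      (return_times N (\<lambda>s. pseudo_shift (f s) (w s)) (\<lambda>s. ball (fin_vec l (a s)) r) x)"
    if U_open: "open U" "U \<noteq> {}" for U :: "'a c0 set"
  proof -
    obtain x0 \<eta> where U: "\<eta> > 0" "ball x0 \<eta> \<subseteq> U"
      using U_open by (meson ex_in_conv openE)
    obtain x p where x: "dist x0 x < \<eta>" "\<And>n s. n \<in> A \<Longrightarrow> n \<ge> p \<Longrightarrow> s \<in> {1..N} \<Longrightarrow>
        dist (fin_vec l (a s)) ((pseudo_shift (f s) (w s) ^^ n) x) \<le> C * \<epsilon>"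
      using simultaneous_perturbation[OF data weight_criterion_subset[OF B(2) A(2)] disj C a_le nz \<epsilon>(1) U(1)]
      by metis
    have "A \<inter> {p..} \<subseteq>
        return_times N (\<lambda>s. pseudo_shift (f s) (w s)) (\<lambda>s. ball (fin_vec l (a s)) r) x"
      unfolding return_times_def using le_less_trans[OF x(2) \<epsilon>(2)] \<delta>(3) by auto
    then show ?thesis
      using x(1) U(2) dense_windows_mono[OF dense_windows_tail[OF \<delta>(2,1)]] by (intro bexI[of _ x]) auto
  qed
  then show ?thesis
    using \<delta>(1) by (intro exI[of _ "\<delta> / 2"]) simp
qed

lemma hypercyclic_of_weight_criterion:
  fixes f :: "nat \<Rightarrow> nat \<Rightarrow> nat" and w :: "nat \<Rightarrow> nat \<Rightarrow> 'a::{real_normed_field, euclidean_space}"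
  assumes data: "\<And>s. s \<in> {1..N} \<Longrightarrow> pseudo_shift_data (f s) (w s)"
    and \<A>: "\<And>A. A \<in> \<A> \<longleftrightarrow> A \<subseteq> {1..} \<and> (\<exists>\<delta>>0. dense_windows K \<delta> A)"
    and apr: "almost_partition_regular \<A> N f"
    and crit: "\<And>l a \<epsilon>. l \<ge> 1 \<Longrightarrow> \<epsilon> > 0 \<Longrightarrow> \<forall>s\<in>{1..N}. \<forall>j\<in>{1..l}. a s j \<noteq> 0 \<Longrightarrow>
      \<exists>A\<in>\<A>. weight_criterion N f w l a \<epsilon> A"
  shows "disjoint_hypercyclic \<A> N (\<lambda>s. pseudo_shift (f s) (w s))"
proof -
  let ?T = "\<lambda>s. pseudo_shift (f s) (w s)"
  obtain \<V> :: "(nat \<Rightarrow> 'a c0 set) set" where \<V>: "countable \<V>"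
      "\<And>V. V \<in> \<V> \<Longrightarrow> \<exists>l\<ge>1. \<exists>a. \<exists>r>0.
        (\<forall>s\<in>{1..N}. \<forall>j\<in>{1..l}. a s j \<noteq> 0) \<and> V = (\<lambda>s. ball (fin_vec l (a s)) r)"
      "\<And>W. \<forall>s\<in>{1..N}. open (W s) \<and> W s \<noteq> {} \<Longrightarrow> \<exists>V\<in>\<V>. \<forall>s\<in>{1..N}. V s \<subseteq> W s"
    using countable_target_base[of N] by blast
  have "\<exists>\<delta>>0. \<forall>U. open U \<and> U \<noteq> {} \<longrightarrow> (\<exists>x\<in>U. dense_windows K \<delta> (return_times N ?T V x))"
    if V: "V \<in> \<V>" for V
  proof -
    obtain l a r where l: "l \<ge> 1" and r: "r > 0" and nz: "\<forall>s\<in>{1..N}. \<forall>j\<in>{1..l}. a s j \<noteq> 0"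
        and V_eq: "V = (\<lambda>s. ball (fin_vec l (a s)) r)"
      using \<V>(2)[OF V] by blast
    have "\<exists>A\<in>\<A>. weight_criterion N f w l a \<epsilon> A" if "\<epsilon> > 0" for \<epsilon>
      using crit[OF l that nz] .
    from dense_returns_near_every_point[OF data \<A> apr this nz l r] show ?thesis
      unfolding V_eq .
  qed
  then obtain \<delta> where \<delta>: "\<And>V. V \<in> \<V> \<Longrightarrow> \<delta> V > 0"
      "\<And>V U. V \<in> \<V> \<Longrightarrow> open U \<Longrightarrow> U \<noteq> {} \<Longrightarrow> \<exists>x\<in>U. dense_windows K (\<delta> V) (return_times N ?T V x)"
    by metis
  have open_V: "open (V s)" if "V \<in> \<V>" for V s
    using \<V>(2)[OF that] by auto
  have "\<exists>x. \<forall>W. (\<forall>s\<in>{1..N}. open (W s) \<and> W s \<noteq> {}) \<longrightarrow>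
      (\<exists>V\<in>\<V>. dense_windows K (\<delta> V) (return_times N ?T W x))"
    by (rule Baire_common_return_point, rule continuous_on_pseudo_shift, erule data, rule \<V>(1),
        erule open_V, erule \<V>(3), erule (2) \<delta>(2))
  then obtain x where x: "\<And>W. \<forall>s\<in>{1..N}. open (W s) \<and> W s \<noteq> {} \<Longrightarrow>
      \<exists>V\<in>\<V>. dense_windows K (\<delta> V) (return_times N ?T W x)"
    by blast
  have "return_times N ?T W x \<in> \<A>" if "\<forall>s\<in>{1..N}. open (W s) \<and> W s \<noteq> {}" for W
    unfolding \<A> using x[OF that] \<delta>(1) by (auto simp: return_times_def)
  then show ?thesis
    unfolding disjoint_hypercyclic_def return_times_def by blast
qed

theorem theorem3p6:
  fixes N :: nat
    and f :: "nat \<Rightarrow> nat \<Rightarrow> nat"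
    and w :: "nat \<Rightarrow> nat \<Rightarrow> 'a::{real_normed_field, euclidean_space}"
    and \<A> :: "nat set set"
  assumes "N \<ge> 2"
    and "\<And>s. s \<in> {1..N} \<Longrightarrow> pseudo_shift_data (f s) (w s)"
    and "\<A> = A_uBd \<or> \<A> = A_ud"
    and "almost_partition_regular \<A> N f"
  shows "disjoint_hypercyclic \<A> N (\<lambda>s. pseudo_shift (f s) (w s)) \<longleftrightarrow>
    (\<forall>l\<ge>1. \<forall>a :: nat \<Rightarrow> nat \<Rightarrow> 'a. \<forall>\<epsilon>>0.
      (\<forall>s\<in>{1..N}. \<forall>j\<in>{1..l}. a s j \<noteq> 0) \<longrightarrow>
      (\<exists>A\<in>\<A>.
        (\<forall>j\<in>{1..l}. \<forall>s\<in>{1..N}.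
          filterlim (\<lambda>n. norm (weight_prod (f s) (w s) j n)) at_top
            (inf sequentially (principal A))) \<and>
        (\<forall>j\<in>{1..l}. \<forall>n\<in>A. \<forall>s\<in>{1..N}. \<forall>t\<in>{1..N}. \<forall>m\<in>A.
          (f t ^^ m) j \<in> (f s ^^ n) ` {l<..} \<longrightarrow>
          norm (weight_prod (f s) (w s) (iter_inv (f s) n ((f t ^^ m) j)) n)
            / norm (weight_prod (f t) (w t) j m) \<le> \<epsilon>) \<and>
        (\<forall>n\<in>A. \<forall>s\<in>{1..N}. \<forall>t\<in>{1..N}. s \<noteq> t \<longrightarrow>
          (\<forall>j\<in>(f t ^^ n) ` {1..l} \<inter> (f s ^^ n) ` {1..l}.
            norm (weight_prod (f s) (w s) (iter_inv (f s) n j) n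
                    / weight_prod (f t) (w t) (iter_inv (f t) n j) n
                  - a s (iter_inv (f s) n j) / a t (iter_inv (f t) n j)) \<le> \<epsilon>))))"
  unfolding weight_criterion_def[symmetric]
proof
  assume "disjoint_hypercyclic \<A> N (\<lambda>s. pseudo_shift (f s) (w s))"
  then show "\<forall>l\<ge>1. \<forall>a. \<forall>\<epsilon>>0. (\<forall>s\<in>{1..N}. \<forall>j\<in>{1..l}. a s j \<noteq> 0) \<longrightarrow>
      (\<exists>A\<in>\<A>. weight_criterion N f w l a \<epsilon> A)"
    using weight_criterion_of_hypercyclic assms(2) by blast
next
  assume crit: "\<forall>l\<ge>1. \<forall>a. \<forall>\<epsilon>>0. (\<forall>s\<in>{1..N}. \<forall>j\<in>{1..l}. a s j \<noteq> 0) \<longrightarrow>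
      (\<exists>A\<in>\<A>. weight_criterion N f w l a \<epsilon> A)"
  obtain K where "\<And>A. A \<in> \<A> \<longleftrightarrow> A \<subseteq> {1..} \<and> (\<exists>\<delta>>0. dense_windows K \<delta> A)"
    using assms(3) A_ud_iff A_uBd_iff by metis
  then show "disjoint_hypercyclic \<A> N (\<lambda>s. pseudo_shift (f s) (w s))"
    using hypercyclic_of_weight_criterion[of N f w \<A> K] assms(2,4) crit by blast
qed

end
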